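(* Let $|\Omega|<\infty$, $\alpha\in[0,1)$, $r>0$, and let $S=(S_t)_{t=0,\dots,T}$ be a nonnegative adapted stock price process. The model satisfies (NA) if and only if there exists a probability measure $Q\sim P$ such that $$E_Q\left(\frac{S_{\tau} - \alpha(S_{\tau}-S_i)}{(1+(1-\alpha)r)^{\tau}}\right) \le E_Q\left(\frac{S_i}{(1+(1-\alpha)r)^i}\right)\quad \text{for all } i=0,\ldots,T-1,\ \tau\in\mathcal{T}_i,$$ where $\mathcal{T}_i$ denotes the set of $\{i,\ldots,T\}$-valued stopping times.
   Context: Setting. Fix $T\in\mathbb{N}=\{1,2,\dots\}$ and a filtered probability space $(\Omega,\mathcal{F},(\mathcal{F}_t)_{t=0,1,\ldots,T},P)$. There is one non-shortable risky stock with price process $S=(S_t)_{t=0,\ldots,T}$, $S_t\in L^0_+(\Omega,\mathcal{F}_t,P)$ (nonnegative real-valued $\mathcal{F}_t$-measurable random variables). The riskless interest rate is a constant $r>0$ and the tax rate a constant $\alpha\in[0,1)$. Strategies. A stock strategy is a family $N=(N_{s,u})_{0\le s\le u\le T}$ with $N_{s,u}\in L^0_+(\Omega,\mathcal{F}_u,P)$ and $N_{s,s}\ge N_{s,s+1}\ge\dots\ge N_{s,T}=0$ for all $s\in\{0,\dots,T\}$ ($N_{s,u}$ is the number of shares bought at time $s$ and still held after trading at time $u$). A pair $(\eta,N)$ with $N$ a stock strategy and $\eta=(\eta_u)_{u=0,\dots,T}$, $\eta_u\in L^0(\Omega,\mathcal{F}_u,P)$, is self-financing for zero initial capital iff, with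 $\eta_{-1}:=0$, for all $u\in\{0,\dots,T\}$, $$\eta_u-\eta_{u-1}=(1-\alpha)r\,\eta_{u-1}-N_{u,u}S_u+\sum_{s=0}^{u-1}(N_{s,u-1}-N_{s,u})\bigl(S_u-\alpha(S_u-S_s)\bigr).$$ It is an arbitrage iff $P(\eta_T\ge0)=1$ and $P(\eta_T>0)>0$. The model satisfies no-arbitrage (NA) iff no arbitrage exists. *)

theory Defs
  imports "HOL-Probability.Probability"
begin

text \<open>
  A filtration over the time index set \<open>{0..T}\<close> is a library filtration indexed by \<open>nat\<close> of which
  only the members up to time \<open>T\<close> matter; every family indexed by \<open>{0..T}\<close> extends to such a
  filtration by keeping it constant after \<open>T\<close>.

  As usual for elements of \<open>L\<^sup>0(\<Omega>, \<F>\<^sub>t, P)\<close>, equalities and inequalities between random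
  variables are understood almost surely.
\<close>

definition filtered_prob_space :: "nat \<Rightarrow> 'a measure \<Rightarrow> (nat \<Rightarrow> 'a measure) \<Rightarrow> bool" where
  "filtered_prob_space T P F \<longleftrightarrow>
     prob_space P \<and> filtration (space P) F \<and> (\<forall>t\<le>T. subalgebra P (F t))"

definition stock_price :: "nat \<Rightarrow> 'a measure \<Rightarrow> (nat \<Rightarrow> 'a measure) \<Rightarrow> (nat \<Rightarrow> 'a \<Rightarrow> real) \<Rightarrow> bool" where
  "stock_price T P F S \<longleftrightarrow>
     (\<forall>t\<le>T. S t \<in> borel_measurable (F t) \<and> (AE \<omega> in P. S t \<omega> \<ge> 0))"

text \<open>
  \<open>N s u\<close> is the number of shares bought at time \<open>s\<close> and still held after trading at time \<open>u\<close>;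
  its values outside \<open>s \<le> u \<le> T\<close> are irrelevant.
\<close>

definition stock_strategy ::
  "nat \<Rightarrow> 'a measure \<Rightarrow> (nat \<Rightarrow> 'a measure) \<Rightarrow> (nat \<Rightarrow> nat \<Rightarrow> 'a \<Rightarrow> real) \<Rightarrow> bool" where
  "stock_strategy T P F N \<longleftrightarrow>
     (\<forall>s u. s \<le> u \<and> u \<le> T \<longrightarrow>
        N s u \<in> borel_measurable (F u) \<and> (AE \<omega> in P. N s u \<omega> \<ge> 0)) \<and>
     (\<forall>s u. s \<le> u \<and> u < T \<longrightarrow> (AE \<omega> in P. N s u \<omega> \<ge> N s (Suc u) \<omega>)) \<and>
     (\<forall>s\<le>T. AE \<omega> in P. N s T \<omega> = 0)"

text \<open>The bank account before trading at time \<open>u\<close>, with the convention \<open>\<eta>\<^bsub>-1\<^esub> = 0\<close>.\<close>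

definition prev_account :: "(nat \<Rightarrow> 'a \<Rightarrow> real) \<Rightarrow> nat \<Rightarrow> 'a \<Rightarrow> real" where
  "prev_account \<eta> u \<omega> = (if u = 0 then 0 else \<eta> (u - 1) \<omega>)"

definition self_financing ::
  "nat \<Rightarrow> 'a measure \<Rightarrow> (nat \<Rightarrow> 'a measure) \<Rightarrow> (nat \<Rightarrow> 'a \<Rightarrow> real) \<Rightarrow> real \<Rightarrow> real \<Rightarrow>
   (nat \<Rightarrow> 'a \<Rightarrow> real) \<Rightarrow> (nat \<Rightarrow> nat \<Rightarrow> 'a \<Rightarrow> real) \<Rightarrow> bool" where
  "self_financing T P F S r \<alpha> \<eta> N \<longleftrightarrow>
     stock_strategy T P F N \<and>
     (\<forall>u\<le>T. \<eta> u \<in> borel_measurable (F u)) \<and>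
     (\<forall>u\<le>T. AE \<omega> in P.
        \<eta> u \<omega> - prev_account \<eta> u \<omega> =
          (1 - \<alpha>) * r * prev_account \<eta> u \<omega> - N u u \<omega> * S u \<omega>
          + (\<Sum>s<u. (N s (u - 1) \<omega> - N s u \<omega>) * (S u \<omega> - \<alpha> * (S u \<omega> - S s \<omega>))))"

definition arbitrage ::
  "nat \<Rightarrow> 'a measure \<Rightarrow> (nat \<Rightarrow> 'a measure) \<Rightarrow> (nat \<Rightarrow> 'a \<Rightarrow> real) \<Rightarrow> real \<Rightarrow> real \<Rightarrow>
   (nat \<Rightarrow> 'a \<Rightarrow> real) \<Rightarrow> (nat \<Rightarrow> nat \<Rightarrow> 'a \<Rightarrow> real) \<Rightarrow> bool" where
  "arbitrage T P F S r \<alpha> \<eta> N \<longleftrightarrow>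
     self_financing T P F S r \<alpha> \<eta> N \<and>
     measure P {\<omega> \<in> space P. \<eta> T \<omega> \<ge> 0} = 1 \<and>
     measure P {\<omega> \<in> space P. \<eta> T \<omega> > 0} > 0"

definition no_arbitrage ::
  "nat \<Rightarrow> 'a measure \<Rightarrow> (nat \<Rightarrow> 'a measure) \<Rightarrow> (nat \<Rightarrow> 'a \<Rightarrow> real) \<Rightarrow> real \<Rightarrow> real \<Rightarrow> bool" where
  "no_arbitrage T P F S r \<alpha> \<longleftrightarrow> \<not> (\<exists>\<eta> N. arbitrage T P F S r \<alpha> \<eta> N)"

definition equivalent_prob_measure :: "'a measure \<Rightarrow> 'a measure \<Rightarrow> bool" where
  "equivalent_prob_measure P Q \<longleftrightarrow>
     prob_space Q \<and> sets Q = sets P \<and> absolutely_continuous P Q \<and> absolutely_continuous Q P"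

definition stopping_times_from ::
  "nat \<Rightarrow> 'a measure \<Rightarrow> (nat \<Rightarrow> 'a measure) \<Rightarrow> nat \<Rightarrow> ('a \<Rightarrow> nat) set" where
  "stopping_times_from T P F i = {\<tau>. stopping_time F \<tau> \<and> (\<forall>\<omega>\<in>space P. \<tau> \<omega> \<in> {i..T})}"

end

theory Submission
  imports Defs
begin

text \<open>
  Discounting turns the terminal wealth of a self-financing strategy into a sum, over the purchase
  times \<open>s\<close>, of the gains of the holdings \<open>N s\<close> against the increments of the discounted after-tax
  sale value \<open>X s\<close>. If \<open>Q\<close> satisfies the stopping time inequalities, every decreasing holding has
  nonpositive expected gain, because it mixes holdings of single shares sold at stopping times.
  Conversely, up to values off the sample space there are only finitely many stopping times, and
  (NA) says that the cone spanned by their gains meets the nonnegative random variables only in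
  \<open>0\<close>; Farkas' lemma, applied once for each point outside the null sets, then yields a strictly
  positive separating functional, which is normalised to \<open>Q\<close>.
\<close>

section \<open>Linear inequalities in finitely many variables\<close>

text \<open>Bartl's induction: if the vectors \<open>g j\<close>, \<open>j \<in> J\<close>, do not suffice, a point \<open>x0\<close> at which
  the implication fails for \<open>J\<close> serves to project everything along \<open>g a\<close>.\<close>

lemma farkas:
  fixes g :: "'j \<Rightarrow> 'k \<Rightarrow> real"
  assumes "finite K" "finite J"
    and "\<And>x. (\<And>j. j \<in> J \<Longrightarrow> (\<Sum>k\<in>K. g j k * x k) \<le> 0) \<Longrightarrow> (\<Sum>k\<in>K. b k * x k) \<le> 0"
  shows "\<exists>l. (\<forall>j\<in>J. 0 \<le> l j) \<and> (\<forall>k\<in>K. b k = (\<Sum>j\<in>J. l j * g j k))"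
  using assms(2,3)
proof (induction J arbitrary: g b rule: finite_induct)
  case empty
  \<comment> \<open>Without constraints the implication may be tested at
    \<open>x = b\<close>.\<close>
  have "(\<Sum>k\<in>K. b k * b k) \<le> 0"
    using empty by simp
  then have "\<forall>k\<in>K. b k = 0"
    using sum_nonneg_eq_0_iff[OF assms(1), of "\<lambda>k. b k * b k"]
    by (smt (verit) sum_nonneg zero_le_square mult_eq_0_iff)
  then show ?case by simp
next
  case (insert a J)
  define ip :: "('k \<Rightarrow> real) \<Rightarrow> ('k \<Rightarrow> real) \<Rightarrow> real" where "ip u x = (\<Sum>k\<in>K. u k * x k)" for u x
  show ?case
  proof (cases "\<forall>x. (\<forall>j\<in>J. ip (g j) x \<le> 0) \<longrightarrow> ip b x \<le> 0")
    case True
    then obtain l where l: "\<forall>j\<in>J. 0 \<le> l j" "\<forall>k\<in>K. b k = (\<Sum>j\<in>J. l j * g j k)"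
      using insert.IH[of g b] unfolding ip_def by metis
    have "(\<Sum>j\<in>insert a J. (l(a := 0)) j * g j k) = (\<Sum>j\<in>J. l j * g j k)" for k
      using insert.hyps by (auto intro!: sum.cong)
    then show ?thesis using l by (intro exI[of _ "l(a := 0)"]) auto
  next
    case False
    then obtain y where y: "\<And>j. j \<in> J \<Longrightarrow> ip (g j) y \<le> 0" "0 < ip b y"
      by force
    \<comment> \<open>Otherwise \<open>y\<close> would meet all constraints of
      \<open>insert a J\<close>, and the hypothesis would contradict
      \<open>0 < ip b y\<close>.\<close>
    have ay: "0 < ip (g a) y"
      using insert.prems[of y] y unfolding ip_def by force
    define x0 where "x0 k = y k / ip (g a) y" for k
    have ip_x0: "ip u x0 = ip u y / ip (g a) y" for u
      unfolding ip_def x0_def by (simp add: sum_divide_distrib)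
    have a1: "ip (g a) x0 = 1" and j0: "\<And>j. j \<in> J \<Longrightarrow> ip (g j) x0 \<le> 0" and b0: "0 < ip b x0"
      using ay y by (auto simp: ip_x0 divide_nonpos_pos)
    have ip_left: "ip (\<lambda>k. u k - d * v k) x = ip u x - d * ip v x"
      and ip_right: "ip x (\<lambda>k. u k - d * v k) = ip x u - d * ip x v" for u v x d
      unfolding ip_def by (simp_all add: algebra_simps sum_subtractf sum_distrib_left)
    define pr where "pr u = (\<lambda>k. u k - ip u x0 * g a k)" for u
    \<comment> \<open>The adjoint of \<open>pr\<close> moves \<open>x\<close> along
      \<open>x0\<close> into the kernel of \<open>g a\<close>. There the constraint of
      \<open>a\<close> holds with equality, so the projected vectors satisfy the implication with
      the constraints of \<open>J\<close> alone.\<close>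
    have ip_pr: "ip (pr u) x = ip u (\<lambda>k. x k - ip (g a) x * x0 k)" for u x
      unfolding pr_def ip_left ip_right by simp
    have "\<exists>l. (\<forall>j\<in>J. 0 \<le> l j) \<and> (\<forall>k\<in>K. pr b k = (\<Sum>j\<in>J. l j * pr (g j) k))"
    proof (rule insert.IH)
      fix x assume *: "\<And>j. j \<in> J \<Longrightarrow> (\<Sum>k\<in>K. pr (g j) k * x k) \<le> 0"
      let ?z = "\<lambda>k. x k - ip (g a) x * x0 k"
      have "ip (g a) ?z = 0" unfolding ip_right using a1 by simp
      moreover have "ip (g j) ?z \<le> 0" if "j \<in> J" for j
        using *[OF that] ip_pr[of "g j" x] unfolding ip_def by simp
      ultimately have "ip b ?z \<le> 0"
        unfolding ip_def by (intro insert.prems) auto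
      then show "(\<Sum>k\<in>K. pr b k * x k) \<le> 0"
        using ip_pr[of b x] unfolding ip_def by simp
    qed
    then obtain l where l: "\<And>j. j \<in> J \<Longrightarrow> 0 \<le> l j"
      "\<And>k. k \<in> K \<Longrightarrow> pr b k = (\<Sum>j\<in>J. l j * pr (g j) k)" by blast
    \<comment> \<open>Undoing the projections leaves this multiple of \<open>g a\<close>. It is
      nonnegative because \<open>b\<close> is positive at \<open>x0\<close> and every
      \<open>g j\<close> is nonpositive there.\<close>
    define c where "c = ip b x0 - (\<Sum>j\<in>J. l j * ip (g j) x0)"
    have "(\<Sum>j\<in>J. l j * ip (g j) x0) \<le> 0"
      using l j0 by (intro sum_nonpos) (simp add: mult_nonneg_nonpos)
    then have c: "0 \<le> c" using b0 by (simp add: c_def)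
    have "b k = (\<Sum>j\<in>insert a J. (l(a := c)) j * g j k)" if "k \<in> K" for k
    proof -
      have "(\<Sum>j\<in>insert a J. (l(a := c)) j * g j k) = c * g a k + (\<Sum>j\<in>J. l j * g j k)"
        using insert.hyps by (auto intro!: sum.cong)
      moreover have "b k = ip b x0 * g a k + (\<Sum>j\<in>J. l j * g j k - l j * ip (g j) x0 * g a k)"
        using l(2)[OF that] by (simp add: pr_def algebra_simps)
      ultimately show ?thesis
        unfolding c_def sum_subtractf by (simp add: sum_distrib_right left_diff_distrib)
    qed
    then show ?thesis using l c by (intro exI[of _ "l(a := c)"]) auto
  qed
qed

section \<open>Layer decomposition and summation identities\<close>

text \<open>Let \<open>w v\<close> be the gap between \<open>v\<close> and the next smaller element
  of \<open>insert 0 V\<close>; the gaps up to \<open>n\<close> telescope to \<open>n\<close>. The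
  weights serve all \<open>n\<close> at once, which later makes them independent of the sample
  point.\<close>

lemma layer_weights:
  fixes V :: "real set"
  assumes "finite V" "\<And>v. v \<in> V \<Longrightarrow> 0 < v"
  shows "\<exists>w. (\<forall>v\<in>V. 0 \<le> w v) \<and> (\<forall>n\<in>insert 0 V. n = (\<Sum>v\<in>V. w v * of_bool (v \<le> n)))"
  using assms
proof (induction V rule: finite_linorder_max_induct)
  case empty
  then show ?case by simp
next
  case (insert b A)
  then obtain w where w: "\<forall>v\<in>A. 0 \<le> w v" "\<forall>n\<in>insert 0 A. n = (\<Sum>v\<in>A. w v * of_bool (v \<le> n))"
    by auto
  \<comment> \<open>Elements enter in increasing order, so the new top layer has thickness
    \<open>b - m\<close>; inserting \<open>0\<close> covers empty \<open>A\<close>.\<close>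
  define m where "m = Max (insert 0 A)"
  have m: "m \<in> insert 0 A" "\<And>v. v \<in> A \<Longrightarrow> v \<le> m"
    unfolding m_def using insert.hyps Max_in[of "insert 0 A"] by (auto simp del: Max_insert intro: Max_ge)
  have mb: "m < b" using m(1) insert by auto
  have b: "b \<notin> A" using insert by auto
  let ?w = "w(b := b - m)"
  have eq: "(\<Sum>v\<in>insert b A. ?w v * of_bool (v \<le> n)) = (b - m) * of_bool (b \<le> n) + (\<Sum>v\<in>A. w v * of_bool (v \<le> n))" for n
    using insert b by (auto intro!: sum.cong)
  have "(\<Sum>v\<in>A. w v * of_bool (v \<le> b)) = (\<Sum>v\<in>A. w v * of_bool (v \<le> m))"
    using m insert by (intro sum.cong) (auto simp: less_imp_le)
  also have "\<dots> = m" using w(2) m(1) by auto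
  finally have "b = (\<Sum>v\<in>insert b A. ?w v * of_bool (v \<le> b))" unfolding eq by simp
  moreover have "n = (\<Sum>v\<in>insert b A. ?w v * of_bool (v \<le> n))" if "n \<in> insert 0 A" for n
  proof -
    have "\<not> b \<le> n" using that insert.hyps insert.prems[of b] by auto
    then show ?thesis unfolding eq using bspec[OF w(2) that] by simp
  qed
  moreover have "\<forall>v\<in>insert b A. 0 \<le> ?w v" using w(1) mb by auto
  ultimately show ?case by (intro exI[of _ ?w]) blast
qed

text \<open>Abel summation. The left side is the cash flow of buying \<open>n s\<close> units at
  \<open>s\<close> and selling off the decreases; the right side is the profit of the holdings
  against the price increments, corrected for units unsold at \<open>m\<close>.\<close>

lemma summation_by_parts:
  fixes n x :: "nat \<Rightarrow> real"
  assumes "s \<le> m"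
  shows "- n s * x s + (\<Sum>v\<in>{s<..m}. (n (v - 1) - n v) * x v)
    = (\<Sum>u\<in>{s..<m}. n u * (x (Suc u) - x u)) - n m * x m"
  using assms
proof (induction m rule: dec_induct)
  case base
  then show ?case by simp
next
  case (step m)
  have "{s<..Suc m} = insert (Suc m) {s<..m}" "{s..<Suc m} = insert m {s..<m}"
    using step by auto
  then show ?case using step by (simp add: algebra_simps)
qed

lemma sum_increments_stopped:
  fixes x :: "nat \<Rightarrow> real"
  assumes "s \<le> t" "t \<le> T"
  shows "(\<Sum>u\<in>{s..<T}. of_bool (u < t) * (x (Suc u) - x u)) = x t - x s"
proof -
  have "(\<Sum>u\<in>{s..<T}. of_bool (u < t) * (x (Suc u) - x u)) = (\<Sum>u\<in>{s..<t}. x (Suc u) - x u)"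
    using assms by (intro sum.mono_neutral_cong_right) auto
  also have "\<dots> = x t - x s" using assms(1) by (rule sum_Suc_diff')
  finally show ?thesis .
qed

lemma discounted_sum:
  fixes c \<eta> :: "nat \<Rightarrow> real"
  assumes "R \<noteq> 0" "\<And>u. u \<le> T \<Longrightarrow> \<eta> u = R * (if u = 0 then 0 else \<eta> (u - 1)) + c u"
  shows "\<eta> T = R ^ T * (\<Sum>v\<le>T. c v / R ^ v)"
proof -
  have "u \<le> T \<Longrightarrow> \<eta> u = R ^ u * (\<Sum>v\<le>u. c v / R ^ v)" for u
  proof (induction u)
    case 0
    then show ?case using assms(2)[of 0] by simp
  next
    case (Suc u)
    then show ?case using assms(1) assms(2)[of "Suc u"] by (simp add: field_simps)
  qed
  then show ?thesis by simp
qed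

text \<open>Exchanging the order of summation groups the flows by purchase time, and summation by
  parts applies to each group. Buying involves no tax, so the purchase price is \<open>x v v\<close>
  after discounting; the boundary terms vanish because everything is sold by
  \<open>T\<close>.\<close>

lemma discounted_cash_flow:
  fixes n :: "nat \<Rightarrow> nat \<Rightarrow> real" and S :: "nat \<Rightarrow> real" and R \<alpha> :: real
  defines "x \<equiv> \<lambda>s u. (S u - \<alpha> * (S u - S s)) / R ^ u"
  assumes "\<And>s. s \<le> T \<Longrightarrow> n s T = 0"
  shows "(\<Sum>v\<le>T. (- n v v * S v + (\<Sum>s<v. (n s (v - 1) - n s v) * (S v - \<alpha> * (S v - S s)))) / R ^ v)
    = (\<Sum>s\<le>T. \<Sum>u\<in>{s..<T}. n s u * (x s (Suc u) - x s u))"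
proof -
  have "(\<Sum>v\<le>T. (- n v v * S v + (\<Sum>s<v. (n s (v - 1) - n s v) * (S v - \<alpha> * (S v - S s)))) / R ^ v)
     = (\<Sum>v\<le>T. - n v v * x v v) + (\<Sum>v\<le>T. \<Sum>s<v. (n s (v - 1) - n s v) * x s v)"
    unfolding x_def add_divide_distrib sum_divide_distrib sum.distrib by simp
  also have "(\<Sum>v\<le>T. \<Sum>s<v. (n s (v - 1) - n s v) * x s v)
     = (\<Sum>s\<le>T. \<Sum>v\<in>{s<..T}. (n s (v - 1) - n s v) * x s v)"
    by (subst (1 2) sum.Sigma, simp, simp, simp, simp,
        rule sum.reindex_bij_witness[of _ "\<lambda>(a,b). (b,a)" "\<lambda>(a,b). (b,a)"]) auto
  finally show ?thesis
    using summation_by_parts[of _ T "n _" "x _"] assms(2)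
    by (simp flip: sum.distrib)
qed

section \<open>Separation by an equivalent measure on a finite space\<close>

lemma integrable_finite_space:
  fixes f :: "'a \<Rightarrow> real"
  assumes "prob_space Q" "finite (space Q)" "f \<in> borel_measurable Q"
  shows "integrable Q f"
proof -
  interpret prob_space Q by fact
  have "norm (f \<omega>) \<le> (\<Sum>\<omega>\<in>space Q. norm (f \<omega>))" if "\<omega> \<in> space Q" for \<omega>
    by (rule member_le_sum) (use that assms in auto)
  then show ?thesis
    using assms(3) by (intro integrable_const_bound[where B = "\<Sum>\<omega>\<in>space Q. norm (f \<omega>)"]) auto
qed

text \<open>A finite Kreps-Yan argument. If no nonnegative weight polar to all \<open>g j\<close>
  charged some point \<open>a\<close> outside the null sets, Farkas' lemma would produce a
  combination of the \<open>g j\<close> dominating the indicator of \<open>a\<close>, against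
  \<open>na\<close>.\<close>

lemma equivalent_measure_polar:
  fixes g :: "'j \<Rightarrow> 'a \<Rightarrow> real"
  assumes "prob_space P" "finite (space P)" "finite J"
    and g: "\<And>j. j \<in> J \<Longrightarrow> g j \<in> borel_measurable P"
    and na: "\<And>l. \<lbrakk>\<forall>j\<in>J. 0 \<le> l j; AE \<omega> in P. 0 \<le> (\<Sum>j\<in>J. l j * g j \<omega>)\<rbrakk>
      \<Longrightarrow> AE \<omega> in P. (\<Sum>j\<in>J. l j * g j \<omega>) \<le> 0"
  shows "\<exists>Q. equivalent_prob_measure P Q \<and> (\<forall>j\<in>J. integral\<^sup>L Q (g j) \<le> 0)"
proof -
  interpret P: prob_space P by fact
  \<comment> \<open>Atoms of the \<open>\<sigma>\<close>-algebra need not be singletons, so \<open>Q\<close> is built as a weighted point measure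
    on the whole space and then restricted to the events of \<open>P\<close>.\<close>
  define Z where "Z = \<Union>(null_sets P)"
  \<comment> \<open>There are only finitely many null sets, so \<open>Z\<close> is itself null and
    the largest one. Hence almost surely means everywhere on \<open>K\<close>, even for predicates
    that are not measurable.\<close>
  define K where "K = space P - Z"
  have "null_sets P \<subseteq> Pow (space P)"
    using sets.sets_into_space by (auto simp: null_sets_def)
  then have "finite (null_sets P)"
    using assms(2) finite_subset by blast
  then have "(\<Union>B\<in>null_sets P. B) \<in> null_sets P"
    by (intro null_sets_UN' countable_finite) auto
  then have Z: "Z \<in> null_sets P" by (simp add: Z_def)
  have K: "finite K" "K \<subseteq> space P" using assms(2) by (auto simp: K_def)
  have AE_K: "(AE \<omega> in P. \<phi> \<omega>) \<longleftrightarrow> (\<forall>\<omega>\<in>K. \<phi> \<omega>)" for \<phi>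
  proof
    assume "AE \<omega> in P. \<phi> \<omega>"
    then obtain B where B: "{\<omega>\<in>space P. \<not> \<phi> \<omega>} \<subseteq> B" "B \<in> null_sets P"
      by (auto elim!: AE_E simp: null_sets_def)
    then show "\<forall>\<omega>\<in>K. \<phi> \<omega>" by (auto simp: K_def Z_def)
  next
    assume "\<forall>\<omega>\<in>K. \<phi> \<omega>"
    then show "AE \<omega> in P. \<phi> \<omega>"
      by (intro AE_I'[OF Z]) (auto simp: K_def)
  qed
  have null_iff: "B \<in> null_sets P \<longleftrightarrow> B \<inter> K = {}" if "B \<in> sets P" for B
    using AE_K[of "\<lambda>\<omega>. \<omega> \<notin> B"] that by (auto simp flip: AE_iff_null_sets)
  have "K \<noteq> {}"
    using null_iff[OF sets.top] P.emeasure_space_1 by auto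

  have "\<exists>q. (\<forall>\<omega>\<in>K. 0 \<le> q \<omega>) \<and> 0 < q a \<and> (\<forall>j\<in>J. (\<Sum>\<omega>\<in>K. g j \<omega> * q \<omega>) \<le> 0)"
    if a: "a \<in> K" for a
  proof (rule ccontr)
    assume neg: "\<not> ?thesis"
    \<comment> \<open>The negated unit vectors encode the constraint \<open>x \<ge> 0\<close>; their
      multipliers \<open>l (Inr k)\<close> become the slack by which the combination of the
      \<open>g j\<close> exceeds the indicator of \<open>a\<close>.\<close>
    define h where "h = case_sum g (\<lambda>b \<omega>. - of_bool (\<omega> = b))"
    have single: "(\<Sum>k\<in>K. of_bool (k = b) * x k) = x b" if "b \<in> K" for b and x :: "'a \<Rightarrow> real"
      using that K by (simp add: of_bool_def if_distrib if_distribR cong: if_cong)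
    have "\<exists>l. (\<forall>j\<in>J <+> K. 0 \<le> l j) \<and> (\<forall>k\<in>K. of_bool (k = a) = (\<Sum>j\<in>J <+> K. l j * h j k))"
    proof (rule farkas)
      fix x assume x: "\<And>j. j \<in> J <+> K \<Longrightarrow> (\<Sum>k\<in>K. h j k * x k) \<le> 0"
      have "(\<Sum>k\<in>K. g j k * x k) \<le> 0" if "j \<in> J" for j
        using x[of "Inl j"] that by (auto simp: h_def)
      moreover have "0 \<le> x b" if "b \<in> K" for b
        using x[of "Inr b"] that by (auto simp: h_def sum_negf single)
      ultimately have "\<not> 0 < x a" using neg by blast
      then show "(\<Sum>k\<in>K. of_bool (k = a) * x k) \<le> 0" by (simp add: single a)
    qed (use K assms in auto)
    then obtain l where l: "\<forall>j\<in>J <+> K. 0 \<le> l j"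
      "\<And>k. k \<in> K \<Longrightarrow> of_bool (k = a) = (\<Sum>j\<in>J <+> K. l j * h j k)" by blast
    have eq: "(\<Sum>j\<in>J. l (Inl j) * g j k) = of_bool (k = a) + l (Inr k)" if "k \<in> K" for k
    proof -
      have "(\<Sum>b\<in>K. l (Inr b) * of_bool (k = b)) = l (Inr k)"
        using single[OF that, of "\<lambda>b. l (Inr b)"] by (simp add: mult.commute eq_commute)
      then show ?thesis
        using l(2)[OF that] K assms(3) by (simp add: sum.Plus h_def sum_negf)
    qed
    have nonneg: "0 \<le> l (Inr k)" if "k \<in> K" for k using l(1) that by auto
    have "AE \<omega> in P. (\<Sum>j\<in>J. l (Inl j) * g j \<omega>) \<le> 0"
      using l(1) by (intro na[of "\<lambda>j. l (Inl j)"]) (auto simp: AE_K eq nonneg)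
    then have "(\<Sum>j\<in>J. l (Inl j) * g j a) \<le> 0" using a by (simp add: AE_K)
    then show False using eq[OF a] nonneg[OF a] by simp
  qed
  then obtain q where q: "\<And>a \<omega>. a \<in> K \<Longrightarrow> \<omega> \<in> K \<Longrightarrow> 0 \<le> q a \<omega>" "\<And>a. a \<in> K \<Longrightarrow> 0 < q a a"
      "\<And>a j. a \<in> K \<Longrightarrow> j \<in> J \<Longrightarrow> (\<Sum>\<omega>\<in>K. g j \<omega> * q a \<omega>) \<le> 0"
    by metis
  \<comment> \<open>Summing keeps the polar inequalities, and the summand
    \<open>q \<omega> \<omega>\<close> makes the total positive at every point of
    \<open>K\<close>.\<close>
  define p where "p \<omega> = (\<Sum>a\<in>K. q a \<omega>)" for \<omega>
  have p: "0 < p \<omega>" if "\<omega> \<in> K" for \<omega>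
    unfolding p_def using that K q by (intro sum_pos2[of K \<omega>]) auto
  define c where "c = (\<Sum>\<omega>\<in>K. p \<omega>)"
  have c: "0 < c" unfolding c_def using p K \<open>K \<noteq> {}\<close> by (intro sum_pos) auto
  define f where "f \<omega> = (if \<omega> \<in> K then p \<omega> / c else 0)" for \<omega>
  have f: "0 \<le> f \<omega>" "f \<omega> = 0 \<longleftrightarrow> \<omega> \<notin> K" for \<omega>
    using p[of \<omega>] c by (auto simp: f_def)
  define M where "M = point_measure (space P) (\<lambda>\<omega>. ennreal (f \<omega>))"
  define Q where "Q = distr M P id"
  have id: "id \<in> measurable M P" by (simp add: M_def)
  have sets_Q: "sets Q = sets P" and space_Q: "space Q = space P" by (simp_all add: Q_def)
  have emeasure_Q: "emeasure Q B = (\<Sum>\<omega>\<in>B. ennreal (f \<omega>))" if "B \<in> sets P" for B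
  proof -
    have "B \<subseteq> space P" using that by (rule sets.sets_into_space)
    then have "id -` B \<inter> space M = B" by (auto simp: M_def space_point_measure)
    then show ?thesis
      unfolding Q_def using that id \<open>B \<subseteq> space P\<close> assms(2)
      by (simp add: emeasure_distr) (simp add: M_def emeasure_point_measure_finite)
  qed
  have sum_f: "(\<Sum>\<omega>\<in>space P. f \<omega> * x \<omega>) = (\<Sum>\<omega>\<in>K. p \<omega> * x \<omega>) / c" for x
  proof -
    have "(\<Sum>\<omega>\<in>space P. f \<omega> * x \<omega>) = (\<Sum>\<omega>\<in>K. p \<omega> / c * x \<omega>)"
      using K assms(2) by (intro sum.mono_neutral_cong_right) (auto simp: f_def)
    then show ?thesis by (simp add: sum_divide_distrib)
  qed
  have "emeasure Q (space Q) = ennreal (\<Sum>\<omega>\<in>space P. f \<omega>)"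
    by (simp add: space_Q emeasure_Q f)
  also have "(\<Sum>\<omega>\<in>space P. f \<omega>) = 1"
    using sum_f[of "\<lambda>_. 1"] c by (simp add: c_def)
  finally have "prob_space Q" by (intro prob_spaceI) simp
  moreover have "B \<in> null_sets Q \<longleftrightarrow> B \<in> null_sets P" for B
  proof (cases "B \<in> sets P")
    case True
    then have "finite B" using sets.sets_into_space[OF True] assms(2) finite_subset by blast
    then have "B \<in> null_sets Q \<longleftrightarrow> (\<forall>\<omega>\<in>B. f \<omega> = 0)"
      using True f(1) sum_nonneg_eq_0_iff[of B f] sum_nonneg[of B f]
      by (simp add: null_sets_def sets_Q emeasure_Q ennreal_eq_0_iff order_antisym_conv)
    then show ?thesis using null_iff[OF True] f(2) by auto
  qed (auto simp: null_sets_def sets_Q)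
  ultimately have "equivalent_prob_measure P Q"
    by (auto simp: equivalent_prob_measure_def sets_Q absolutely_continuous_def)
  moreover have "integral\<^sup>L Q (g j) \<le> 0" if "j \<in> J" for j
  proof -
    have "integral\<^sup>L Q (g j) = integral\<^sup>L M (g j)"
      unfolding Q_def by (subst integral_distr[OF id]) (use g that in auto)
    also have "\<dots> = (\<Sum>\<omega>\<in>K. p \<omega> * g j \<omega>) / c"
      unfolding M_def using assms(2) f by (simp add: lebesgue_integral_point_measure_finite sum_f)
    also have "(\<Sum>\<omega>\<in>K. p \<omega> * g j \<omega>) = (\<Sum>a\<in>K. \<Sum>\<omega>\<in>K. g j \<omega> * q a \<omega>)"
      unfolding p_def sum_distrib_right by (subst sum.swap) (simp add: mult.commute)
    also have "\<dots> / c \<le> 0"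
      by (intro divide_nonpos_pos sum_nonpos[of K] q(3)[OF _ that] c)
    finally show ?thesis .
  qed
  ultimately show ?thesis by blast
qed

section \<open>The market, discounted sale values and gains of single shares\<close>

locale finite_market =
  fixes T :: nat and P :: "'a measure" and F :: "nat \<Rightarrow> 'a measure"
    and S :: "nat \<Rightarrow> 'a \<Rightarrow> real" and r \<alpha> :: real
  assumes fps: "filtered_prob_space T P F"
    and finite_space: "finite (space P)"
    and \<alpha>_less: "\<alpha> < 1" and r_pos: "0 < r"
    and stock: "stock_price T P F S"
begin

sublocale prob_space P
  using fps by (simp add: filtered_prob_space_def)

lemma space_F [simp]: "space (F t) = space P"
  using fps by (simp add: filtered_prob_space_def filtration_def)

lemma measurable_F_mono:
  assumes "f \<in> measurable (F s) N" "s \<le> t"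
  shows "f \<in> measurable (F t) N"
  using fps assms by (intro measurable_from_subalg[of "F t" "F s"])
    (auto simp: filtered_prob_space_def filtration_def subalgebra_def)

lemma measurable_F_P:
  assumes "f \<in> measurable (F t) N" "t \<le> T"
  shows "f \<in> measurable P N"
  using fps assms by (intro measurable_from_subalg[of P "F t"]) (auto simp: filtered_prob_space_def)

lemma S_measurable: "s \<le> t \<Longrightarrow> t \<le> T \<Longrightarrow> S s \<in> borel_measurable (F t)"
  using stock measurable_F_mono[of "S s" s borel t] by (auto simp: stock_price_def)

definition R :: real where "R = 1 + (1 - \<alpha>) * r"

lemma R_pos: "0 < R"
  using \<alpha>_less r_pos by (simp add: R_def add_pos_pos)

text \<open>On the diagonal the tax term vanishes, so \<open>X s s\<close> is the discounted
  purchase price and, for \<open>u > s\<close>, \<open>X s u\<close> the discounted after-tax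
  proceeds of a share bought at \<open>s\<close>.\<close>

definition X :: "nat \<Rightarrow> nat \<Rightarrow> 'a \<Rightarrow> real" where
  "X s u \<omega> = (S u \<omega> - \<alpha> * (S u \<omega> - S s \<omega>)) / R ^ u"

lemma X_measurable: "s \<le> u \<Longrightarrow> u \<le> T \<Longrightarrow> X s u \<in> borel_measurable P"
  unfolding X_def using S_measurable[of s u] S_measurable[of u u]
  by (intro measurable_F_P[of _ u]) auto

text \<open>The discounted profit from one share bought at \<open>s\<close> and sold at
  \<open>\<tau>\<close>. The inequality of the theorem becomes a sign condition on its
  integral.\<close>

definition gain :: "nat \<Rightarrow> ('a \<Rightarrow> nat) \<Rightarrow> 'a \<Rightarrow> real" where
  "gain s \<tau> \<omega> = X s (\<tau> \<omega>) \<omega> - X s s \<omega>"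

lemma gain_eq_sum:
  assumes "\<tau> \<in> stopping_times_from T P F s" "\<omega> \<in> space P"
  shows "gain s \<tau> \<omega> = (\<Sum>u\<in>{s..<T}. of_bool (u < \<tau> \<omega>) * (X s (Suc u) \<omega> - X s u \<omega>))"
proof -
  have "s \<le> \<tau> \<omega>" "\<tau> \<omega> \<le> T" using assms by (auto simp: stopping_times_from_def)
  then show ?thesis
    unfolding gain_def by (rule sum_increments_stopped[symmetric])
qed

text \<open>The share sold at \<open>\<tau>\<close> is gone after trading at \<open>\<tau>\<close>,
  hence the strict inequality. The event is the complement of \<open>\<tau> \<le> u\<close> and so
  known at \<open>u\<close>.\<close>

lemma held_measurable:
  assumes "\<tau> \<in> stopping_times_from T P F s"
  shows "(\<lambda>\<omega>. of_bool (u < \<tau> \<omega>) :: real) \<in> borel_measurable (F u)"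
proof -
  have [measurable]: "Measurable.pred (F u) (\<lambda>\<omega>. u < \<tau> \<omega>)"
    using assms by (intro stopping_timeD2) (simp add: stopping_times_from_def)
  show ?thesis by measurable
qed

text \<open>The sum over increments replaces evaluation at a random time by finitely many measurable
  terms.\<close>

lemma gain_measurable:
  assumes "\<tau> \<in> stopping_times_from T P F s"
  shows "gain s \<tau> \<in> borel_measurable P"
proof -
  have "(\<lambda>\<omega>. \<Sum>u\<in>{s..<T}. of_bool (u < \<tau> \<omega>) * (X s (Suc u) \<omega> - X s u \<omega>)) \<in> borel_measurable P"
    using held_measurable[OF assms, THEN measurable_F_P]
    by (intro borel_measurable_sum borel_measurable_times borel_measurable_diff X_measurable) auto
  then show ?thesis
    by (rule measurable_cong[THEN iffD1, rotated]) (simp add: gain_eq_sum[OF assms])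
qed

lemma integral_gain:
  assumes "prob_space Q" "sets Q = sets P" "\<tau> \<in> stopping_times_from T P F s" "s \<le> T"
  shows "integral\<^sup>L Q (gain s \<tau>) = (\<integral>\<omega>. X s (\<tau> \<omega>) \<omega> \<partial>Q) - integral\<^sup>L Q (X s s)"
proof -
  have sp: "space Q = space P" using assms(2) by (rule sets_eq_imp_space_eq)
  have int: "integrable Q f" if "f \<in> borel_measurable P" for f :: "'a \<Rightarrow> real"
    using assms that finite_space sp
    by (intro integrable_finite_space) (auto cong: measurable_cong_sets)
  note g = gain_measurable[OF assms(3)] and x = X_measurable[OF order.refl assms(4)]
  have "(\<integral>\<omega>. X s (\<tau> \<omega>) \<omega> \<partial>Q) = (\<integral>\<omega>. gain s \<tau> \<omega> + X s s \<omega> \<partial>Q)"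
    by (simp add: gain_def)
  also have "\<dots> = integral\<^sup>L Q (gain s \<tau>) + integral\<^sup>L Q (X s s)"
    using int[OF g] int[OF x] by simp
  finally show ?thesis by simp
qed

section \<open>From the measure to the absence of arbitrage\<close>

text \<open>A decreasing holding is a positive combination of its level indicators, and each level
  indicator is the holding of one share up to a stopping time.\<close>

lemma decreasing_holding_gain_nonpos:
  assumes "prob_space Q" and sets_Q: "sets Q = sets P"
    and gain_le: "\<And>\<tau>. \<tau> \<in> stopping_times_from T P F s \<Longrightarrow> integral\<^sup>L Q (gain s \<tau>) \<le> 0"
    and s: "s \<le> T"
    and n: "\<And>u. s \<le> u \<Longrightarrow> u < T \<Longrightarrow> n u \<in> borel_measurable (F u)"
    and nonneg: "AE \<omega> in Q. \<forall>u\<in>{s..<T}. 0 \<le> n u \<omega>"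
    and decr: "AE \<omega> in Q. \<forall>u\<in>{s..<T}. Suc u < T \<longrightarrow> n (Suc u) \<omega> \<le> n u \<omega>"
  shows "(\<integral>\<omega>. (\<Sum>u\<in>{s..<T}. n u \<omega> * (X s (Suc u) \<omega> - X s u \<omega>)) \<partial>Q) \<le> 0"
proof -
  interpret Q: prob_space Q by fact
  have space_Q: "space Q = space P" using sets_Q by (rule sets_eq_imp_space_eq)
  \<comment> \<open>The positive values of the holding over all times and sample points. They are
    finitely many, so finitely many levels with deterministic weights suffice.\<close>
  define V where "V = (\<lambda>(u, \<omega>). n u \<omega>) ` ({s..<T} \<times> space P) \<inter> {0<..}"
  have fin_V: "finite V" unfolding V_def using finite_space by auto
  have "\<And>v. v \<in> V \<Longrightarrow> 0 < v" by (simp add: V_def)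
  from layer_weights[OF fin_V this] obtain w where w: "\<And>v. v \<in> V \<Longrightarrow> 0 \<le> w v"
      "\<And>x. x \<in> insert 0 V \<Longrightarrow> x = (\<Sum>v\<in>V. w v * of_bool (v \<le> x))"
    by blast
  \<comment> \<open>The first time at which fewer than \<open>v\<close> shares are held; the
    alternative \<open>u = T\<close> guarantees that the minimum exists.\<close>
  define \<tau> where "\<tau> v \<omega> = (LEAST u. s \<le> u \<and> (n u \<omega> < v \<or> u = T))" for v \<omega>
  have \<tau>_least: "s \<le> \<tau> v \<omega> \<and> (n (\<tau> v \<omega>) \<omega> < v \<or> \<tau> v \<omega> = T)" for v \<omega>
    unfolding \<tau>_def by (rule LeastI[of _ T]) (use s in simp)
  have \<tau>_le: "\<tau> v \<omega> \<le> u" if "s \<le> u" "n u \<omega> < v \<or> u = T" for v \<omega> u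
    unfolding \<tau>_def by (rule Least_le) (use that in simp)
  have \<tau>_le_T: "\<tau> v \<omega> \<le> T" for v \<omega> using \<tau>_le[of T] s by simp
  \<comment> \<open>This describes the event \<open>\<tau> v \<omega> \<le> t\<close> by finitely
    many holdings known at time \<open>t\<close>, which yields the stopping time property.\<close>
  have \<tau>_iff: "\<tau> v \<omega> \<le> t \<longleftrightarrow> T \<le> t \<or> (\<exists>u\<in>{s..<T} \<inter> {..t}. n u \<omega> < v)" for v \<omega> t
  proof
    assume "\<tau> v \<omega> \<le> t"
    then show "T \<le> t \<or> (\<exists>u\<in>{s..<T} \<inter> {..t}. n u \<omega> < v)"
      using \<tau>_least[of v \<omega>] \<tau>_le_T[of v \<omega>] by (cases "\<tau> v \<omega> = T") auto
  next
    assume "T \<le> t \<or> (\<exists>u\<in>{s..<T} \<inter> {..t}. n u \<omega> < v)"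
    then show "\<tau> v \<omega> \<le> t"
      using \<tau>_le_T[of v \<omega>] \<tau>_le[of _ \<omega> v] by (meson IntE atLeastLessThan_iff atMost_iff order.trans)
  qed
  have stop: "\<tau> v \<in> stopping_times_from T P F s" for v
  proof -
    have "Measurable.pred (F t) (\<lambda>\<omega>. n u \<omega> < v)" if "u \<in> {s..<T} \<inter> {..t}" for t u
    proof -
      have [measurable]: "n u \<in> borel_measurable (F t)"
        using that n[of u] by (auto intro: measurable_F_mono)
      show ?thesis by measurable
    qed
    then have "Measurable.pred (F t) (\<lambda>\<omega>. T \<le> t \<or> (\<exists>u\<in>{s..<T} \<inter> {..t}. n u \<omega> < v))" for t
      by (intro pred_intros_logic pred_intros_finite) auto
    then have "stopping_time F (\<tau> v)"
      unfolding stopping_time_def \<tau>_iff by blast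
    then show ?thesis
      using \<tau>_least \<tau>_le_T by (auto simp: stopping_times_from_def)
  qed
  have "AE \<omega> in Q. (\<Sum>u\<in>{s..<T}. n u \<omega> * (X s (Suc u) \<omega> - X s u \<omega>)) = (\<Sum>v\<in>V. w v * gain s (\<tau> v) \<omega>)"
    using nonneg decr AE_space
  proof eventually_elim
    case (elim \<omega>)
    have mono: "n u' \<omega> \<le> n u \<omega>" if "s \<le> u" "u \<le> u'" "u' < T" for u u'
      using that(2,3)
    proof (induction u' rule: dec_induct)
      case (step m)
      then have "n (Suc m) \<omega> \<le> n m \<omega>" using elim(2) that(1) by auto
      then show ?case using step by simp
    qed simp
    \<comment> \<open>Monotonicity enters here: a holding that has fallen below \<open>v\<close>
      stays below, so the level set is exactly the period before \<open>\<tau> v\<close>.\<close>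
    have held: "v \<le> n u \<omega> \<longleftrightarrow> u < \<tau> v \<omega>" if "u \<in> {s..<T}" for u v
    proof -
      have "n u \<omega> < v" if "n u' \<omega> < v" "s \<le> u'" "u' \<le> u" for u'
        using mono[of u' u] that \<open>u \<in> {s..<T}\<close> by simp
      then have "\<tau> v \<omega> \<le> u \<longleftrightarrow> n u \<omega> < v"
        unfolding \<tau>_iff using that by auto
      then show ?thesis by linarith
    qed
    have "n u \<omega> = (\<Sum>v\<in>V. w v * of_bool (u < \<tau> v \<omega>))" if "u \<in> {s..<T}" for u
    proof -
      have "n u \<omega> \<in> insert 0 V"
        using elim that by (force simp: V_def space_Q)
      from w(2)[OF this] show ?thesis by (simp add: held[OF that])
    qed
    then have "(\<Sum>u\<in>{s..<T}. n u \<omega> * (X s (Suc u) \<omega> - X s u \<omega>))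
      = (\<Sum>u\<in>{s..<T}. \<Sum>v\<in>V. w v * (of_bool (u < \<tau> v \<omega>) * (X s (Suc u) \<omega> - X s u \<omega>)))"
      by (intro sum.cong refl) (simp only: sum_distrib_right mult.assoc)
    also have "\<dots> = (\<Sum>v\<in>V. w v * gain s (\<tau> v) \<omega>)"
      using elim(3) unfolding space_Q
      by (subst sum.swap) (simp only: gain_eq_sum[OF stop] sum_distrib_left)
    finally show ?case .
  qed
  moreover have gain_Q: "gain s (\<tau> v) \<in> borel_measurable Q" for v
    using gain_measurable[OF stop] sets_Q by (simp cong: measurable_cong_sets)
  moreover have "(\<lambda>\<omega>. \<Sum>u\<in>{s..<T}. n u \<omega> * (X s (Suc u) \<omega> - X s u \<omega>)) \<in> borel_measurable Q"
  proof -
    have "(\<lambda>\<omega>. \<Sum>u\<in>{s..<T}. n u \<omega> * (X s (Suc u) \<omega> - X s u \<omega>)) \<in> borel_measurable P"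
      using n[THEN measurable_F_P]
      by (intro borel_measurable_sum borel_measurable_times borel_measurable_diff X_measurable) auto
    then show ?thesis using sets_Q by (simp cong: measurable_cong_sets)
  qed
  ultimately have "(\<integral>\<omega>. (\<Sum>u\<in>{s..<T}. n u \<omega> * (X s (Suc u) \<omega> - X s u \<omega>)) \<partial>Q)
    = (\<integral>\<omega>. (\<Sum>v\<in>V. w v * gain s (\<tau> v) \<omega>) \<partial>Q)"
    by (intro integral_cong_AE) auto
  also have "\<dots> = (\<Sum>v\<in>V. w v * integral\<^sup>L Q (gain s (\<tau> v)))"
    using integrable_finite_space[OF assms(1) _ gain_Q] finite_space
    by (subst Bochner_Integration.integral_sum) (auto simp: space_Q)
  also have "\<dots> \<le> 0"
    using w(1) gain_le[OF stop] by (intro sum_nonpos mult_nonneg_nonpos) auto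
  finally show ?thesis .
qed

text \<open>Terminal wealth is \<open>R ^ T\<close> times the sum of the gains of the holdings, so
  its expectation under \<open>Q\<close> is nonpositive. If it is also nonnegative, it vanishes
  almost surely under \<open>Q\<close>, hence under \<open>P\<close>.\<close>

lemma no_arbitrage_if_gain_nonpos:
  assumes Q: "equivalent_prob_measure P Q"
    and gain_le: "\<And>s \<tau>. s < T \<Longrightarrow> \<tau> \<in> stopping_times_from T P F s \<Longrightarrow> integral\<^sup>L Q (gain s \<tau>) \<le> 0"
  shows "no_arbitrage T P F S r \<alpha>"
  unfolding no_arbitrage_def
proof (rule notI, elim exE)
  fix \<eta> N assume arb: "arbitrage T P F S r \<alpha> \<eta> N"
  have pQ: "prob_space Q" and sets_Q: "sets Q = sets P"
    and PQ: "absolutely_continuous P Q" and QP: "absolutely_continuous Q P"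
    using Q by (auto simp: equivalent_prob_measure_def)
  interpret Q: prob_space Q by fact
  have space_Q: "space Q = space P" using sets_Q by (rule sets_eq_imp_space_eq)
  have AE_Q: "AE \<omega> in Q. \<phi> \<omega>" if "AE \<omega> in P. \<phi> \<omega>" for \<phi>
    using absolutely_continuous_AE[OF sets_Q PQ that] .
  have sf: "self_financing T P F S r \<alpha> \<eta> N" and strat: "stock_strategy T P F N"
    using arb by (auto simp: arbitrage_def self_financing_def)
  let ?G = "\<lambda>s \<omega>. \<Sum>u\<in>{s..<T}. N s u \<omega> * (X s (Suc u) \<omega> - X s u \<omega>)"
  have N: "N s u \<in> borel_measurable (F u)" if "s \<le> u" "u \<le> T" for s u
    using strat that by (simp add: stock_strategy_def)
  have \<eta>T: "\<eta> T \<in> borel_measurable P"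
    using sf by (auto simp: self_financing_def intro: measurable_F_P)
  then have \<eta>T_Q: "\<eta> T \<in> borel_measurable Q"
    using sets_Q by (simp cong: measurable_cong_sets)
  have G: "?G s \<in> borel_measurable Q" if "s \<le> T" for s
  proof -
    have "?G s \<in> borel_measurable P"
      using N[THEN measurable_F_P]
      by (intro borel_measurable_sum borel_measurable_times borel_measurable_diff X_measurable) auto
    then show ?thesis using sets_Q by (simp cong: measurable_cong_sets)
  qed
  have G_nonpos: "integral\<^sup>L Q (?G s) \<le> 0" if "s \<le> T" for s
  \<comment> \<open>The hypothesis covers purchases before \<open>T\<close> only; a purchase at
    \<open>T\<close> is sold at once and gives an empty sum.\<close>
  proof (cases "s = T")
    case False
    then have "s < T" using that by simp
    show ?thesis
    proof (rule decreasing_holding_gain_nonpos[OF pQ sets_Q gain_le[OF \<open>s < T\<close>] that])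
      show "AE \<omega> in Q. \<forall>u\<in>{s..<T}. 0 \<le> N s u \<omega>"
        using strat by (intro AE_Q AE_finite_allI) (auto simp: stock_strategy_def)
      show "AE \<omega> in Q. \<forall>u\<in>{s..<T}. Suc u < T \<longrightarrow> N s (Suc u) \<omega> \<le> N s u \<omega>"
        using strat by (intro AE_Q AE_finite_allI) (auto simp: stock_strategy_def)
    qed (use N in auto)
  qed simp
  have fin: "AE \<omega> in P. \<forall>u\<in>{..T}.
        \<eta> u \<omega> - prev_account \<eta> u \<omega> =
          (1 - \<alpha>) * r * prev_account \<eta> u \<omega> - N u u \<omega> * S u \<omega>
          + (\<Sum>s<u. (N s (u - 1) \<omega> - N s u \<omega>) * (S u \<omega> - \<alpha> * (S u \<omega> - S s \<omega>)))"
    using sf by (intro AE_finite_allI) (auto simp: self_financing_def)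
  have "AE \<omega> in P. \<forall>s\<in>{..T}. N s T \<omega> = 0"
    using strat by (intro AE_finite_allI) (auto simp: stock_strategy_def)
  with fin have "AE \<omega> in P. \<eta> T \<omega> = R ^ T * (\<Sum>s\<le>T. ?G s \<omega>)"
  proof eventually_elim
    case (elim \<omega>)
    have "\<eta> T \<omega> = R ^ T * (\<Sum>v\<le>T. (- N v v \<omega> * S v \<omega>
        + (\<Sum>s<v. (N s (v - 1) \<omega> - N s v \<omega>) * (S v \<omega> - \<alpha> * (S v \<omega> - S s \<omega>)))) / R ^ v)"
    proof (rule discounted_sum[of R T "\<lambda>u. \<eta> u \<omega>"])
      fix u assume "u \<le> T"
      then show "\<eta> u \<omega> = R * (if u = 0 then 0 else \<eta> (u - 1) \<omega>) + (- N u u \<omega> * S u \<omega>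
        + (\<Sum>s<u. (N s (u - 1) \<omega> - N s u \<omega>) * (S u \<omega> - \<alpha> * (S u \<omega> - S s \<omega>))))"
        using elim(1) unfolding prev_account_def R_def by (simp add: algebra_simps)
    qed (use R_pos in simp)
    then show ?case
      using discounted_cash_flow[of T "\<lambda>s u. N s u \<omega>" "\<lambda>u. S u \<omega>" \<alpha> R] elim(2)
      by (simp add: X_def)
  qed
  then have "integral\<^sup>L Q (\<eta> T) = (\<integral>\<omega>. R ^ T * (\<Sum>s\<le>T. ?G s \<omega>) \<partial>Q)"
    by (intro integral_cong_AE AE_Q \<eta>T_Q borel_measurable_times borel_measurable_sum G) auto
  also have "\<dots> = R ^ T * (\<Sum>s\<le>T. integral\<^sup>L Q (?G s))"
    using integrable_finite_space[OF pQ _ G] finite_space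
    by (subst integral_mult_right_zero, subst Bochner_Integration.integral_sum) (auto simp: space_Q)
  also have "\<dots> \<le> 0"
    using R_pos G_nonpos by (intro mult_nonneg_nonpos sum_nonpos) auto
  finally have le: "integral\<^sup>L Q (\<eta> T) \<le> 0" .
  have [measurable]: "\<eta> T \<in> borel_measurable P" by fact
  have "AE \<omega> in P. 0 \<le> \<eta> T \<omega>"
    using arb prob_Collect_eq_1[of "\<lambda>\<omega>. 0 \<le> \<eta> T \<omega>"] by (simp add: arbitrage_def)
  then have nonneg: "AE \<omega> in Q. 0 \<le> \<eta> T \<omega>" by (rule AE_Q)
  then have "AE \<omega> in Q. \<eta> T \<omega> = 0"
    using le integral_nonneg_AE[OF nonneg] integrable_finite_space[OF pQ _ \<eta>T_Q] finite_space
    by (subst integral_nonneg_eq_0_iff_AE[symmetric]) (auto simp: space_Q)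
  then have "AE \<omega> in P. \<eta> T \<omega> = 0"
    by (rule absolutely_continuous_AE[OF sets_Q[symmetric] QP])
  then have "AE \<omega> in P. \<not> 0 < \<eta> T \<omega>" by eventually_elim simp
  then have "prob {\<omega> \<in> space P. 0 < \<eta> T \<omega>} = 0"
    by (subst prob_Collect_eq_0) auto
  then show False using arb by (simp add: arbitrage_def)
qed

section \<open>From the absence of arbitrage to the measure\<close>

text \<open>The weights describe a strategy: at \<open>s\<close> buy \<open>l s \<tau>\<close>
  shares for each \<open>\<tau>\<close> in \<open>J s\<close> and sell them at
  \<open>\<tau>\<close>. Its discounted terminal wealth is the combined gain, so a gain that is
  nonnegative and not almost surely zero would be an arbitrage.\<close>

lemma combined_gain_nonpos_if_no_arbitrage:
  assumes na: "no_arbitrage T P F S r \<alpha>"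
    and fin: "\<And>s. s \<le> T \<Longrightarrow> finite (J s)"
    and J: "\<And>s. s \<le> T \<Longrightarrow> J s \<subseteq> stopping_times_from T P F s"
    and l: "\<And>s \<tau>. s \<le> T \<Longrightarrow> \<tau> \<in> J s \<Longrightarrow> 0 \<le> l s \<tau>"
    and nonneg: "AE \<omega> in P. 0 \<le> (\<Sum>s\<le>T. \<Sum>\<tau>\<in>J s. l s \<tau> * gain s \<tau> \<omega>)"
  shows "AE \<omega> in P. (\<Sum>s\<le>T. \<Sum>\<tau>\<in>J s. l s \<tau> * gain s \<tau> \<omega>) \<le> 0"
proof -
  let ?G = "\<lambda>\<omega>. \<Sum>s\<le>T. \<Sum>\<tau>\<in>J s. l s \<tau> * gain s \<tau> \<omega>"
  define N where "N s u \<omega> = (\<Sum>\<tau>\<in>J s. l s \<tau> * of_bool (u < \<tau> \<omega>))" for s u \<omega>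
  define c where "c v \<omega> = - N v v \<omega> * S v \<omega>
    + (\<Sum>s<v. (N s (v - 1) \<omega> - N s v \<omega>) * (S v \<omega> - \<alpha> * (S v \<omega> - S s \<omega>)))" for v \<omega>
  \<comment> \<open>The account recursion in solved form, so that \<open>N\<close> is financed by
    construction.\<close>
  define \<eta> where "\<eta> u \<omega> = R ^ u * (\<Sum>v\<le>u. c v \<omega> / R ^ v)" for u \<omega>
  have N: "N s u \<in> borel_measurable (F t)" if "s \<le> T" "u \<le> t" for s u t
    unfolding N_def using J[OF that(1)] held_measurable[THEN measurable_F_mono, OF _ that(2)]
    by (intro borel_measurable_sum borel_measurable_times) auto
  have NT: "N s T \<omega> = 0" if "s \<le> T" "\<omega> \<in> space P" for s \<omega>
    unfolding N_def using J[OF that(1)] that(2)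
    by (intro sum.neutral) (force simp: stopping_times_from_def)
  have strat: "stock_strategy T P F N"
    unfolding stock_strategy_def
  proof (intro conjI allI impI AE_I2)
    fix s u \<omega> assume "s \<le> u \<and> u < T"
    then show "N s (Suc u) \<omega> \<le> N s u \<omega>"
      unfolding N_def using l by (intro sum_mono mult_left_mono) auto
  qed (use N NT l in \<open>auto simp: N_def intro!: sum_nonneg\<close>)
  have c: "c v \<in> borel_measurable (F u)" if "v \<le> u" "u \<le> T" for v u
    unfolding c_def using that S_measurable N
    by (intro borel_measurable_add borel_measurable_sum borel_measurable_times borel_measurable_diff
          borel_measurable_uminus borel_measurable_const) auto
  have \<eta>: "\<eta> u \<in> borel_measurable (F u)" if "u \<le> T" for u
    unfolding \<eta>_def using c that by auto
  have step: "\<eta> u \<omega> = R * prev_account \<eta> u \<omega> + c u \<omega>" for u \<omega>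
    using R_pos by (cases u) (simp_all add: \<eta>_def prev_account_def field_simps)
  have sf: "self_financing T P F S r \<alpha> \<eta> N"
    unfolding self_financing_def using strat \<eta>
    by (auto intro!: AE_I2 simp: step) (simp add: R_def c_def algebra_simps)
  have eq: "\<eta> T \<omega> = R ^ T * ?G \<omega>" if "\<omega> \<in> space P" for \<omega>
  proof -
    have "(\<Sum>v\<le>T. c v \<omega> / R ^ v) = (\<Sum>s\<le>T. \<Sum>u\<in>{s..<T}. N s u \<omega> * (X s (Suc u) \<omega> - X s u \<omega>))"
      using discounted_cash_flow[of T "\<lambda>s u. N s u \<omega>" "\<lambda>u. S u \<omega>" \<alpha> R] NT[OF _ that]
      by (simp add: c_def X_def)
    also have "\<dots> = ?G \<omega>"
    proof (intro sum.cong refl)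
      fix s assume "s \<in> {..T}"
      then have "gain s \<tau> \<omega> = (\<Sum>u\<in>{s..<T}. of_bool (u < \<tau> \<omega>) * (X s (Suc u) \<omega> - X s u \<omega>))"
        if "\<tau> \<in> J s" for \<tau>
        using J[of s] \<open>\<omega> \<in> space P\<close> that by (intro gain_eq_sum) auto
      then show "(\<Sum>u\<in>{s..<T}. N s u \<omega> * (X s (Suc u) \<omega> - X s u \<omega>)) = (\<Sum>\<tau>\<in>J s. l s \<tau> * gain s \<tau> \<omega>)"
        unfolding N_def sum_distrib_right
        by (subst sum.swap) (simp only: sum_distrib_left mult.assoc cong: sum.cong)
    qed
    finally show ?thesis by (simp add: \<eta>_def)
  qed
  have [measurable]: "\<eta> T \<in> borel_measurable P" using \<eta>[of T] by (auto intro: measurable_F_P)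
  have "AE \<omega> in P. 0 \<le> \<eta> T \<omega>"
    using nonneg AE_space by eventually_elim (use R_pos in \<open>simp add: eq\<close>)
  then have "prob {\<omega> \<in> space P. 0 \<le> \<eta> T \<omega>} = 1"
    by (subst prob_Collect_eq_1) auto
  then have "prob {\<omega> \<in> space P. 0 < \<eta> T \<omega>} = 0"
    using na sf measure_nonneg[of P "{\<omega> \<in> space P. 0 < \<eta> T \<omega>}"]
    unfolding no_arbitrage_def arbitrage_def by (metis order_le_less)
  then have "AE \<omega> in P. \<not> 0 < \<eta> T \<omega>"
    by (subst (asm) prob_Collect_eq_0) auto
  then show ?thesis
    using AE_space by eventually_elim (use R_pos in \<open>simp add: eq zero_less_mult_iff not_less\<close>)
qed

lemma equivalent_measure_if_no_arbitrage:
  assumes na: "no_arbitrage T P F S r \<alpha>"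
  shows "\<exists>Q. equivalent_prob_measure P Q \<and>
    (\<forall>s\<le>T. \<forall>\<tau>\<in>stopping_times_from T P F s. integral\<^sup>L Q (gain s \<tau>) \<le> 0)"
proof -
  \<comment> \<open>Extensionality fixes the values off the sample space; finite domain and range
    then leave finitely many functions.\<close>
  define J where "J s = stopping_times_from T P F s \<inter> (space P \<rightarrow>\<^sub>E {s..T})" for s
  have fin: "finite (J s)" for s
    unfolding J_def using finite_space by (intro finite_Int disjI2 finite_PiE) auto
  have "\<exists>Q. equivalent_prob_measure P Q \<and>
      (\<forall>j\<in>Sigma {..T} J. integral\<^sup>L Q (case_prod gain j) \<le> 0)"
  proof (rule equivalent_measure_polar)
    fix l :: "nat \<times> ('a \<Rightarrow> nat) \<Rightarrow> real"
    assume l: "\<forall>j\<in>Sigma {..T} J. 0 \<le> l j"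
      and nonneg: "AE \<omega> in P. 0 \<le> (\<Sum>j\<in>Sigma {..T} J. l j * case_prod gain j \<omega>)"
    have eq: "(\<Sum>j\<in>Sigma {..T} J. l j * case_prod gain j \<omega>)
        = (\<Sum>s\<le>T. \<Sum>\<tau>\<in>J s. l (s, \<tau>) * gain s \<tau> \<omega>)" for \<omega>
      using fin by (simp add: sum.Sigma case_prod_unfold)
    show "AE \<omega> in P. (\<Sum>j\<in>Sigma {..T} J. l j * case_prod gain j \<omega>) \<le> 0"
      unfolding eq
      by (rule combined_gain_nonpos_if_no_arbitrage[OF na])
         (use l nonneg fin in \<open>auto simp: eq J_def\<close>)
  qed (use fin finite_space prob_space_axioms gain_measurable in \<open>auto simp: J_def\<close>)
  then obtain Q where Q: "equivalent_prob_measure P Q"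
    and le: "\<And>s \<tau>. s \<le> T \<Longrightarrow> \<tau> \<in> J s \<Longrightarrow> integral\<^sup>L Q (gain s \<tau>) \<le> 0" by auto
  have "space Q = space P"
    using Q by (intro sets_eq_imp_space_eq) (simp add: equivalent_prob_measure_def)
  have "integral\<^sup>L Q (gain s \<tau>) \<le> 0" if "s \<le> T" "\<tau> \<in> stopping_times_from T P F s" for s \<tau>
  proof -
    \<comment> \<open>Only values on the sample space matter for being a stopping time and for the
      integral of the gain, so each \<open>\<tau>\<close> may be replaced by its extensional
      representative.\<close>
    have "stopping_time F (restrict \<tau> (space P)) = stopping_time F \<tau>"
      by (rule stopping_time_cong) simp
    then have "restrict \<tau> (space P) \<in> J s"
      using that(2) by (auto simp: J_def stopping_times_from_def)
    then have "integral\<^sup>L Q (gain s (restrict \<tau> (space P))) \<le> 0" by (rule le[OF that(1)])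
    also have "integral\<^sup>L Q (gain s (restrict \<tau> (space P))) = integral\<^sup>L Q (gain s \<tau>)"
      by (rule Bochner_Integration.integral_cong) (auto simp: gain_def \<open>space Q = space P\<close>)
    finally show ?thesis .
  qed
  with Q show ?thesis by blast
qed

section \<open>The equivalence\<close>

text \<open>On a finite space the integrals split, so each inequality says that the corresponding
  \<open>gain\<close> has nonpositive integral; the two preceding directions then apply.\<close>

lemma no_arbitrage_iff:
  "no_arbitrage T P F S r \<alpha> \<longleftrightarrow>
    (\<exists>Q. equivalent_prob_measure P Q \<and>
      (\<forall>i<T. \<forall>\<tau>\<in>stopping_times_from T P F i. (\<integral>\<omega>. X i (\<tau> \<omega>) \<omega> \<partial>Q) \<le> integral\<^sup>L Q (X i i)))"
proof -
  have "(\<integral>\<omega>. X i (\<tau> \<omega>) \<omega> \<partial>Q) \<le> integral\<^sup>L Q (X i i) \<longleftrightarrow> integral\<^sup>L Q (gain i \<tau>) \<le> 0"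
    if "equivalent_prob_measure P Q" "i < T" "\<tau> \<in> stopping_times_from T P F i" for Q i \<tau>
    using that by (subst integral_gain) (auto simp: equivalent_prob_measure_def)
  then show ?thesis
    using no_arbitrage_if_gain_nonpos equivalent_measure_if_no_arbitrage
    by (meson less_imp_le)
qed

end

theorem proposition5p2:
  fixes T :: nat and P :: "'a measure" and F :: "nat \<Rightarrow> 'a measure"
    and S :: "nat \<Rightarrow> 'a \<Rightarrow> real" and r \<alpha> :: real
  assumes "T \<ge> 1"
    and "filtered_prob_space T P F"
    and "finite (space P)"
    and "0 \<le> \<alpha>" "\<alpha> < 1"
    and "r > 0"
    and "stock_price T P F S"
  shows "no_arbitrage T P F S r \<alpha> \<longleftrightarrow>
    (\<exists>Q. equivalent_prob_measure P Q \<and>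
      (\<forall>i<T. \<forall>\<tau>\<in>stopping_times_from T P F i.
        (\<integral>\<omega>. (S (\<tau> \<omega>) \<omega> - \<alpha> * (S (\<tau> \<omega>) \<omega> - S i \<omega>)) / (1 + (1 - \<alpha>) * r) ^ \<tau> \<omega> \<partial>Q)
          \<le> (\<integral>\<omega>. S i \<omega> / (1 + (1 - \<alpha>) * r) ^ i \<partial>Q)))"
proof -
  interpret finite_market T P F S r \<alpha>
    using assms by unfold_locales auto
  show ?thesis
    using no_arbitrage_iff by (simp add: X_def[abs_def] R_def)
qed

end
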